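(* Let $\{c_\sigma : \sigma\in\mathfrak{S}_n\}$ be complex numbers. The following are equivalent: (1) the polynomial $$P(z_1,\ldots,z_n,w_1,\ldots,w_n)=\sum_{\sigma\in\mathfrak{S}_n}c_\sigma\prod_{j=1}^n(z_{\sigma(j)}-w_j)$$ is Grace-like; (2) the linear operator on $\mathcal{M}_n$ defined by $T=\sum_{\sigma\in\mathfrak{S}_n}c_\sigma\,\sigma$ preserves stability; (3) the polynomial $$Q(z_1,\ldots,z_n,w_1,\ldots,w_n)=\sum_{\sigma\in\mathfrak{S}_n}c_\sigma\prod_{j=1}^n(z_{\sigma(j)}+w_j)$$ is stable.
   Context: $\mathfrak{S}_n$ is the symmetric group on $\{1,\ldots,n\}$. It acts on $\mathbb{C}[z_1,\ldots,z_n]$ by $\mathbb{C}$-algebra automorphisms with $\sigma(z_i)=z_{\sigma(i)}$. A polynomial is multiaffine if each variable occurs in it at most to the first power, and $\mathcal{M}_n$ is the space of multiaffine polynomials in $\mathbb{C}[z_1,\ldots,z_n]$. Let $\mathcal{H}=\{z\in\mathbb{C}:\operatorname{Im} z>0\}$; a complex polynomial in $N$ variables is stable if it is nonvanishing on $\mathcal{H}^N$. A linear operator $T$ on $\mathcal{M}_n$ preserves stability if, whenever $f\in\mathcal{M}_n$ is stable, $T(f)$ is either stable or identically zero. A multiaffine complex polynomial $P(z_1,\ldots,z_n,w_1,\ldots,w_n)$ is Grace-like if $P(z_1,\ldots,z_n,w_1,\ldots,w_n)\neq 0$ whenever $z_1,\ldots,z_n$ are separated from $w_1,\ldots,w_n$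 by a circle of the Riemann sphere, i.e. there is a circle or straight line in $\mathbb{C}$ such that all the $z_i$ lie in one of the two connected components of its complement in $\mathbb{C}$ and all the $w_j$ lie in the other component.
   Formalization: The implications from (2) to (1) and (3) are stated only when T is not identically zero on multiaffine polynomials; if T = 0 (e.g. all c_σ = 0), then (2) holds but P = Q = 0 is neither Grace-like nor stable. All other implications are unconditional. *)

theory Defs
  imports
    "HOL-Analysis.Analysis"
    "HOL-Library.Poly_Mapping"
    "HOL-Combinatorics.Permutations"
begin

text \<open>
  Complex polynomials in commuting variables indexed by \<open>'v\<close> are finitely supported functions
  from monomials (exponent functions of finite support) to coefficients; the commutative ring
  structure is the convolution product of \<^theory>\<open>HOL-Library.Poly_Mapping\<close>.
\<close>

type_synonym 'v cpoly = "('v \<Rightarrow>\<^sub>0 nat) \<Rightarrow>\<^sub>0 complex"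

definition Const :: "complex \<Rightarrow> 'v cpoly" where
  "Const a = Poly_Mapping.single 0 a"

definition Var :: "'v \<Rightarrow> 'v cpoly" where
  "Var i = Poly_Mapping.single (Poly_Mapping.single i 1) 1"

definition polys_in :: "'v set \<Rightarrow> 'v cpoly set" where
  "polys_in V = {p. \<forall>m \<in> Poly_Mapping.keys p. Poly_Mapping.keys m \<subseteq> V}"

definition poly_value :: "'v cpoly \<Rightarrow> ('v \<Rightarrow> complex) \<Rightarrow> complex" where
  "poly_value p x =
     (\<Sum>m \<in> Poly_Mapping.keys p. Poly_Mapping.lookup p m *
        (\<Prod>i \<in> Poly_Mapping.keys m. x i ^ Poly_Mapping.lookup m i))"

text \<open>The \<open>\<complex>\<close>-algebra homomorphism that sends each variable \<open>i\<close> to the polynomial \<open>g i\<close>.\<close>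

definition poly_subst :: "('v \<Rightarrow> 'w cpoly) \<Rightarrow> 'v cpoly \<Rightarrow> 'w cpoly" where
  "poly_subst g p =
     (\<Sum>m \<in> Poly_Mapping.keys p. Const (Poly_Mapping.lookup p m) *
        (\<Prod>i \<in> Poly_Mapping.keys m. g i ^ Poly_Mapping.lookup m i))"

definition perm_act :: "('v \<Rightarrow> 'v) \<Rightarrow> 'v cpoly \<Rightarrow> 'v cpoly" where
  "perm_act \<sigma> = poly_subst (\<lambda>i. Var (\<sigma> i))"

definition multiaffine :: "'v cpoly \<Rightarrow> bool" where
  "multiaffine p \<longleftrightarrow> (\<forall>m \<in> Poly_Mapping.keys p. \<forall>i. Poly_Mapping.lookup m i \<le> 1)"

definition multiaffine_space :: "nat \<Rightarrow> nat cpoly set" where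
  "multiaffine_space n = {p \<in> polys_in {1..n}. multiaffine p}"

definition upper_half_plane :: "complex set" where
  "upper_half_plane = {z. Im z > 0}"

text \<open>Stability of a polynomial in the variables indexed by \<open>V\<close>; the zero polynomial is not stable.\<close>

definition stable_poly :: "'v set \<Rightarrow> 'v cpoly \<Rightarrow> bool" where
  "stable_poly V p \<longleftrightarrow> p \<in> polys_in V \<and>
     (\<forall>x. (\<forall>i \<in> V. x i \<in> upper_half_plane) \<longrightarrow> poly_value p x \<noteq> 0)"

definition preserves_stability :: "nat \<Rightarrow> (nat cpoly \<Rightarrow> nat cpoly) \<Rightarrow> bool" where
  "preserves_stability n T \<longleftrightarrow>
     (\<forall>f \<in> multiaffine_space n. stable_poly {1..n} f \<longrightarrow> stable_poly {1..n} (T f) \<or> T f = 0)"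

text \<open>On \<open>complex\<close> the inner product is that of the real plane, so \<open>{x. a \<bullet> x = b}\<close> with
  \<open>a \<noteq> 0\<close> is an arbitrary straight line.\<close>

definition circle_or_line :: "complex set \<Rightarrow> bool" where
  "circle_or_line C \<longleftrightarrow>
     (\<exists>a r. r > 0 \<and> C = sphere a r) \<or> (\<exists>a b. a \<noteq> 0 \<and> C = {x. a \<bullet> x = b})"

definition separated_by_circle :: "complex set \<Rightarrow> complex set \<Rightarrow> bool" where
  "separated_by_circle Z W \<longleftrightarrow>
     (\<exists>C A B. circle_or_line C \<and> A \<in> components (- C) \<and> B \<in> components (- C) \<and> A \<noteq> B \<and>
        Z \<subseteq> A \<and> W \<subseteq> B)"

text \<open>In polynomials in \<open>2n\<close> variables, \<open>Inl j\<close> indexes the variable \<open>z\<^sub>j\<close> and \<open>Inr j\<close> the variable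
  \<open>w\<^sub>j\<close>, for \<open>j \<in> {1..n}\<close>.\<close>

definition zw_vars :: "nat \<Rightarrow> (nat + nat) set" where
  "zw_vars n = Inl ` {1..n} \<union> Inr ` {1..n}"

definition grace_like :: "nat \<Rightarrow> (nat + nat) cpoly \<Rightarrow> bool" where
  "grace_like n p \<longleftrightarrow> p \<in> polys_in (zw_vars n) \<and> multiaffine p \<and>
     (\<forall>z w. separated_by_circle (z ` {1..n}) (w ` {1..n}) \<longrightarrow> poly_value p (case_sum z w) \<noteq> 0)"

definition difference_poly :: "nat \<Rightarrow> ((nat \<Rightarrow> nat) \<Rightarrow> complex) \<Rightarrow> (nat + nat) cpoly" where
  "difference_poly n c =
     (\<Sum>\<sigma> | \<sigma> permutes {1..n}. Const (c \<sigma>) * (\<Prod>j=1..n. Var (Inl (\<sigma> j)) - Var (Inr j)))"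

definition sum_poly :: "nat \<Rightarrow> ((nat \<Rightarrow> nat) \<Rightarrow> complex) \<Rightarrow> (nat + nat) cpoly" where
  "sum_poly n c =
     (\<Sum>\<sigma> | \<sigma> permutes {1..n}. Const (c \<sigma>) * (\<Prod>j=1..n. Var (Inl (\<sigma> j)) + Var (Inr j)))"

definition perm_operator :: "nat \<Rightarrow> ((nat \<Rightarrow> nat) \<Rightarrow> complex) \<Rightarrow> nat cpoly \<Rightarrow> nat cpoly" where
  "perm_operator n c f = (\<Sum>\<sigma> | \<sigma> permutes {1..n}. Const (c \<sigma>) * perm_act \<sigma> f)"

text \<open>If this operator vanishes on the multiaffine polynomials (for example, if all \<open>c \<sigma>\<close> are zero, or
  if \<open>c\<close> is the sign character and \<open>n \<ge> 3\<close>), then it trivially preserves stability, whereas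
  \<open>difference_poly n c\<close> and \<open>sum_poly n c\<close> are zero, hence neither Grace-like nor stable. So an
  implication from stability preservation to one of these properties needs it to be nonzero.\<close>

end

(* A Moebius transformation multiplies each difference z - w by a constant and by one factor depending
   on z and one on w, so the difference polynomial is only changed by nonvanishing factors, and
   every circle can be moved to the real line. Conversely, T maps the product of the z_j + w_j to Q,
   and on the diagonal T multiplies by the sum of the c_sigma; so that sum decides whether T can
   produce stable polynomials at all.

   If Q is stable, f is stable and z is a point of the product of half-planes, enclose the z_j in a
   disc inside the half-plane. The values of f and the factors v_j z_sigma(j) - w_j are then paired
   one variable at a time as in Grace's theorem, with w_j / v_j outside the disc, infinity included,
   until only (T f)(z) remains. *)
theory Submission
  imports Defs
begin

section \<open>Evaluation as a ring homomorphism\<close>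

section \<open>Evaluation of polynomials\<close>

text \<open>All three products are extended to the union of the two supports, where the added
  factors have exponent 0; there the exponents add.\<close>

lemma monomial_value_add:
  fixes x :: "'v \<Rightarrow> complex"
  shows "(\<Prod>i \<in> Poly_Mapping.keys (m + m'). x i ^ Poly_Mapping.lookup (m + m') i) =
    (\<Prod>i \<in> Poly_Mapping.keys m. x i ^ Poly_Mapping.lookup m i) *
    (\<Prod>i \<in> Poly_Mapping.keys m'. x i ^ Poly_Mapping.lookup m' i)"
proof -
  let ?K = "Poly_Mapping.keys m \<union> Poly_Mapping.keys m'"
  have ext: "(\<Prod>i \<in> Poly_Mapping.keys k. x i ^ Poly_Mapping.lookup k i) =
      (\<Prod>i \<in> ?K. x i ^ Poly_Mapping.lookup k i)" if "Poly_Mapping.keys k \<subseteq> ?K" for k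
    using that by (intro prod.mono_neutral_left) (auto simp: in_keys_iff)
  have "Poly_Mapping.keys (m + m') \<subseteq> ?K"
    by (rule keys_add)
  then show ?thesis
    using ext[of "m + m'"] ext[of m] ext[of m'] by (simp add: lookup_add power_add prod.distrib)
qed

lemma poly_value_zero [simp]: "poly_value 0 x = 0"
  by (simp add: poly_value_def)

lemma poly_value_add [simp]: "poly_value (p + q) x = poly_value p x + poly_value q x"
  unfolding poly_value_def
  by (rule setsum_keys_plus_distrib) (auto simp: distrib_right)

lemma poly_value_sum [simp]: "poly_value (\<Sum>i\<in>I. p i) x = (\<Sum>i\<in>I. poly_value (p i) x)"
  by (induction I rule: infinite_finite_induct) auto

lemma poly_value_diff [simp]: "poly_value (p - q) x = poly_value p x - poly_value q x"
  by (metis add_diff_cancel_right' diff_add_cancel poly_value_add)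

lemma poly_value_single:
  "poly_value (Poly_Mapping.single m a) x =
     a * (\<Prod>i \<in> Poly_Mapping.keys m. x i ^ Poly_Mapping.lookup m i)"
  by (simp add: poly_value_def)

lemma poly_value_Const [simp]: "poly_value (Const a) x = a"
  by (simp add: Const_def poly_value_single)

lemma poly_value_Var [simp]: "poly_value (Var i) x = x i"
  by (simp add: Var_def poly_value_single)

lemma sum_of_monomials:
  "p = (\<Sum>m \<in> Poly_Mapping.keys p. Poly_Mapping.single m (Poly_Mapping.lookup p m))"
  by (rule poly_mapping_eqI) (auto simp: lookup_sum lookup_single when_def in_keys_iff)

lemma poly_value_mult [simp]: "poly_value (p * q) x = poly_value p x * poly_value q x"
proof -
  have single: "poly_value (Poly_Mapping.single m a * Poly_Mapping.single m' b) x =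
      poly_value (Poly_Mapping.single m a) x * poly_value (Poly_Mapping.single m' b) x"
    for m m' a b
    by (simp add: mult_single poly_value_single monomial_value_add)
  show ?thesis
    by (subst (1 2) sum_of_monomials[of p], subst (1 2) sum_of_monomials[of q])
      (simp add: sum_product single)
qed

lemma poly_value_one [simp]: "poly_value 1 x = 1"
  using poly_value_Const[of 1 x] by (simp add: Const_def)

lemma poly_value_prod [simp]: "poly_value (\<Prod>i\<in>I. p i) x = (\<Prod>i\<in>I. poly_value (p i) x)"
  by (induction I rule: infinite_finite_induct) auto

lemma poly_value_power [simp]: "poly_value (p ^ k) x = poly_value p x ^ k"
  by (induction k) auto

lemma poly_value_perm_act [simp]: "poly_value (perm_act \<sigma> p) x = poly_value p (\<lambda>i. x (\<sigma> i))"
  by (simp add: perm_act_def poly_subst_def poly_value_def[of p])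

lemma poly_value_perm_operator:
  "poly_value (perm_operator n c f) x =
     (\<Sum>\<sigma> | \<sigma> permutes {1..n}. c \<sigma> * poly_value f (\<lambda>i. x (\<sigma> i)))"
  by (simp add: perm_operator_def)

section \<open>Multiaffine polynomials: closure properties and determination by values\<close>

section \<open>Multiaffine polynomials\<close>

text \<open>Generalizes \<open>multiaffine_space\<close> to any index set, so that products can be
  controlled through the disjointness of the variables of their factors.\<close>

definition multiaffine_in :: "'v set \<Rightarrow> 'v cpoly set" where
  "multiaffine_in V = {p \<in> polys_in V. multiaffine p}"

lemma multiaffine_in_iff:
  "p \<in> multiaffine_in V \<longleftrightarrow>
     (\<forall>m \<in> Poly_Mapping.keys p. Poly_Mapping.keys m \<subseteq> V \<and> (\<forall>i. Poly_Mapping.lookup m i \<le> 1))"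
  by (auto simp: multiaffine_in_def polys_in_def multiaffine_def)

lemma multiaffine_in_zero: "0 \<in> multiaffine_in V"
  by (simp add: multiaffine_in_iff)

lemma multiaffine_in_add:
  "p \<in> multiaffine_in V \<Longrightarrow> q \<in> multiaffine_in V \<Longrightarrow> p + q \<in> multiaffine_in V"
  using keys_add[of p q] unfolding multiaffine_in_iff by blast

lemma multiaffine_in_diff:
  "p \<in> multiaffine_in V \<Longrightarrow> q \<in> multiaffine_in V \<Longrightarrow> p - q \<in> multiaffine_in V"
  using keys_diff[of p q] unfolding multiaffine_in_iff by blast

lemma multiaffine_in_sum:
  "(\<And>i. i \<in> I \<Longrightarrow> p i \<in> multiaffine_in V) \<Longrightarrow> (\<Sum>i\<in>I. p i) \<in> multiaffine_in V"
  by (induction I rule: infinite_finite_induct)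
    (auto simp: multiaffine_in_zero multiaffine_in_add)

lemma multiaffine_in_Const: "Const a \<in> multiaffine_in V"
  by (simp add: multiaffine_in_iff Const_def)

lemma multiaffine_in_Var: "i \<in> V \<Longrightarrow> Var i \<in> multiaffine_in V"
  by (simp add: multiaffine_in_iff Var_def lookup_single when_def)

text \<open>At each index one of the two exponents is 0 because the variable sets are
  disjoint.\<close>

lemma multiaffine_in_mult:
  assumes p: "p \<in> multiaffine_in V" and q: "q \<in> multiaffine_in W" and VW: "V \<inter> W = {}"
  shows "p * q \<in> multiaffine_in (V \<union> W)"
  unfolding multiaffine_in_iff
proof
  fix m assume "m \<in> Poly_Mapping.keys (p * q)"
  then obtain a b where m: "m = a + b" and a: "a \<in> Poly_Mapping.keys p"
    and b: "b \<in> Poly_Mapping.keys q"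
    using keys_mult[of p q] by blast
  have a': "Poly_Mapping.keys a \<subseteq> V" "Poly_Mapping.lookup a i \<le> 1"
    and b': "Poly_Mapping.keys b \<subseteq> W" "Poly_Mapping.lookup b i \<le> 1" for i
    using p q a b by (auto simp: multiaffine_in_iff)
  have "Poly_Mapping.lookup a i = 0 \<or> Poly_Mapping.lookup b i = 0" for i
    using a'(1) b'(1) VW by (auto simp: in_keys_iff subset_iff)
  then have "Poly_Mapping.lookup m i \<le> 1" for i
    using a'(2)[of i] b'(2)[of i] unfolding m lookup_add by (metis add.left_neutral add.right_neutral)
  moreover have "Poly_Mapping.keys m \<subseteq> V \<union> W"
    using keys_add[of a b] a'(1) b'(1) unfolding m by blast
  ultimately show "Poly_Mapping.keys m \<subseteq> V \<union> W \<and> (\<forall>i. Poly_Mapping.lookup m i \<le> 1)"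
    by blast
qed

lemma multiaffine_in_mono: "p \<in> multiaffine_in V \<Longrightarrow> V \<subseteq> W \<Longrightarrow> p \<in> multiaffine_in W"
  unfolding multiaffine_in_iff by blast

lemma multiaffine_in_prod:
  assumes "finite I" and "\<And>i. i \<in> I \<Longrightarrow> p i \<in> multiaffine_in (V i)"
    and "disjoint_family_on V I"
  shows "(\<Prod>i\<in>I. p i) \<in> multiaffine_in (\<Union>i\<in>I. V i)"
  using assms
proof (induction I rule: finite_induct)
  case empty
  show ?case
    using multiaffine_in_Const[of 1] by (simp add: Const_def)
next
  case (insert i I)
  have "V i \<inter> (\<Union>j\<in>I. V j) = {}"
    using insert.prems(2) insert.hyps(2) by (auto simp: disjoint_family_on_def)
  moreover have "(\<Prod>j\<in>I. p j) \<in> multiaffine_in (\<Union>j\<in>I. V j)"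
    using insert by (auto simp: disjoint_family_on_def)
  ultimately show ?case
    using multiaffine_in_mult[of "p i" "V i" "\<Prod>j\<in>I. p j" "\<Union>j\<in>I. V j"] insert by simp
qed

lemma multiaffine_in_Const_mult: "p \<in> multiaffine_in V \<Longrightarrow> Const a * p \<in> multiaffine_in V"
  using multiaffine_in_mult[OF multiaffine_in_Const[of a "{}"], of p V] by simp

text \<open>Injectivity of \<open>\<sigma>\<close> keeps the distinct variables of a monomial
  distinct.\<close>

lemma multiaffine_in_perm_act:
  assumes \<sigma>: "\<sigma> permutes V" and p: "p \<in> multiaffine_in V"
  shows "perm_act \<sigma> p \<in> multiaffine_in V"
  unfolding perm_act_def poly_subst_def
proof (intro multiaffine_in_sum multiaffine_in_Const_mult)
  fix m assume "m \<in> Poly_Mapping.keys p"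
  then have keys: "Poly_Mapping.keys m \<subseteq> V" and le: "\<And>i. Poly_Mapping.lookup m i \<le> 1"
    using p by (auto simp: multiaffine_in_iff)
  have one: "Poly_Mapping.lookup m i = 1" if "i \<in> Poly_Mapping.keys m" for i
    using that le[of i] by (simp add: in_keys_iff)
  have "(\<Prod>i \<in> Poly_Mapping.keys m. Var (\<sigma> i)) \<in> multiaffine_in (\<Union>i \<in> Poly_Mapping.keys m. {\<sigma> i})"
    using permutes_inj[OF \<sigma>]
    by (intro multiaffine_in_prod multiaffine_in_Var) (auto simp: disjoint_family_on_def inj_def)
  moreover have "(\<Union>i \<in> Poly_Mapping.keys m. {\<sigma> i}) \<subseteq> V"
    using keys permutes_in_image[OF \<sigma>] by auto
  ultimately show "(\<Prod>i \<in> Poly_Mapping.keys m. Var (\<sigma> i) ^ Poly_Mapping.lookup m i) \<in> multiaffine_in V"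
    using multiaffine_in_mono by (simp add: one)
qed

lemma multiaffine_in_perm_operator:
  "f \<in> multiaffine_in {1..n} \<Longrightarrow> perm_operator n c f \<in> multiaffine_in {1..n}"
  unfolding perm_operator_def
  by (intro multiaffine_in_sum multiaffine_in_Const_mult multiaffine_in_perm_act) auto

text \<open>For a fixed permutation the factor with index \<open>j\<close> involves only the
  variables \<open>Inl (\<sigma> j)\<close> and \<open>Inr j\<close>, and these pairs are disjoint
  for different \<open>j\<close>.\<close>

lemma multiaffine_in_sum_difference_poly:
  "sum_poly n c \<in> multiaffine_in (zw_vars n)" "difference_poly n c \<in> multiaffine_in (zw_vars n)"
proof -
  have dom: "(\<Union>j\<in>{1..n}. {Inl (\<sigma> j), Inr j}) \<subseteq> zw_vars n"
    and disj: "disjoint_family_on (\<lambda>j. {Inl (\<sigma> j), Inr j}) {1..n}"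
    if "\<sigma> permutes {1..n}" for \<sigma> :: "nat \<Rightarrow> nat"
    using permutes_in_image[OF that] permutes_inj[OF that]
    by (auto simp: zw_vars_def disjoint_family_on_def inj_def simp del: atLeastAtMost_iff)
  have prod: "(\<Prod>j=1..n. q j) \<in> multiaffine_in (zw_vars n)"
    if "\<sigma> permutes {1..n}" and "\<And>j. q j \<in> multiaffine_in {Inl (\<sigma> j), Inr j}" for \<sigma> q
    using multiaffine_in_mono[OF multiaffine_in_prod[OF finite_atLeastAtMost that(2) disj[OF that(1)]] dom[OF that(1)]] .
  show "sum_poly n c \<in> multiaffine_in (zw_vars n)"
    unfolding sum_poly_def
    by (intro multiaffine_in_sum multiaffine_in_Const_mult, rule prod, erule CollectD,
        intro multiaffine_in_add multiaffine_in_Var) auto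
  show "difference_poly n c \<in> multiaffine_in (zw_vars n)"
    unfolding difference_poly_def
    by (intro multiaffine_in_sum multiaffine_in_Const_mult, rule prod, erule CollectD,
        intro multiaffine_in_diff multiaffine_in_Var) auto
qed

text \<open>A monomial containing \<open>k\<close> has exponent 1 there and is linear in
  \<open>t\<close>; the others do not depend on \<open>t\<close>.\<close>

lemma poly_value_affine:
  assumes "multiaffine p"
  shows "poly_value p (y(k := t)) =
    poly_value p (y(k := 0)) + t * (poly_value p (y(k := 1)) - poly_value p (y(k := 0)))"
proof -
  define M where "M t m = (\<Prod>i \<in> Poly_Mapping.keys m. (y(k := t)) i ^ Poly_Mapping.lookup m i)"
    for t m
  have M: "M t m = M 0 m + t * (M 1 m - M 0 m)" if "m \<in> Poly_Mapping.keys p" for m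
  proof (cases "k \<in> Poly_Mapping.keys m")
    case True
    then have "Poly_Mapping.lookup m k = 1"
      using assms that by (metis in_keys_iff le_antisym less_one linorder_not_less multiaffine_def)
    moreover have "M s m = s ^ Poly_Mapping.lookup m k *
        (\<Prod>i \<in> Poly_Mapping.keys m - {k}. y i ^ Poly_Mapping.lookup m i)" for s
      using True unfolding M_def by (simp add: prod.remove)
    ultimately show ?thesis by simp
  next
    case False
    then have "M s m = (\<Prod>i \<in> Poly_Mapping.keys m. y i ^ Poly_Mapping.lookup m i)" for s
      unfolding M_def by (intro prod.cong) auto
    then show ?thesis by simp
  qed
  have "poly_value p (y(k := t)) = (\<Sum>m \<in> Poly_Mapping.keys p. Poly_Mapping.lookup p m * M t m)"
    by (simp add: poly_value_def M_def)
  also have "\<dots> = (\<Sum>m \<in> Poly_Mapping.keys p. Poly_Mapping.lookup p m * M 0 m +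
      t * (Poly_Mapping.lookup p m * M 1 m - Poly_Mapping.lookup p m * M 0 m))"
    by (intro sum.cong refl, subst M) (auto simp: algebra_simps)
  also have "\<dots> = poly_value p (y(k := 0)) +
      t * (poly_value p (y(k := 1)) - poly_value p (y(k := 0)))"
    by (simp add: poly_value_def M_def sum.distrib sum_subtractf flip: sum_distrib_left)
  finally show ?thesis .
qed

text \<open>Evaluate at the indicator of the support of a monomial \<open>m\<close> of
  \<open>p\<close> whose support has least size. Every other monomial of \<open>p\<close> has a
  variable outside that support and vanishes, so the value is the coefficient of
  \<open>m\<close>.\<close>

lemma multiaffine_eq_zero:
  assumes p: "multiaffine p" and zero: "\<And>x. poly_value p x = 0"
  shows "p = 0"
proof (rule ccontr)
  assume "p \<noteq> 0"
  then obtain m where m: "m \<in> Poly_Mapping.keys p"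
    and min: "\<And>m'. m' \<in> Poly_Mapping.keys p \<Longrightarrow>
      card (Poly_Mapping.keys m) \<le> card (Poly_Mapping.keys m')"
    using ex_has_least_nat[of "\<lambda>m. m \<in> Poly_Mapping.keys p" _ "\<lambda>m. card (Poly_Mapping.keys m)"]
    by (metis all_not_in_conv keys_eq_empty)
  have lookup: "Poly_Mapping.lookup m' i = (if i \<in> Poly_Mapping.keys m' then 1 else 0)"
    if "m' \<in> Poly_Mapping.keys p" for m' i
  proof -
    have "Poly_Mapping.lookup m' i \<le> 1"
      using p that by (simp add: multiaffine_def)
    then show ?thesis
      by (cases "Poly_Mapping.lookup m' i") (auto simp: in_keys_iff)
  qed
  define x :: "'a \<Rightarrow> complex" where "x i = (if i \<in> Poly_Mapping.keys m then 1 else 0)" for i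
  have "(\<Prod>i \<in> Poly_Mapping.keys m'. x i ^ Poly_Mapping.lookup m' i) = (if m' = m then 1 else 0)"
    if m': "m' \<in> Poly_Mapping.keys p" for m'
  proof (cases "m' = m")
    case True
    then show ?thesis by (simp add: x_def)
  next
    case False
    have "\<not> Poly_Mapping.keys m' \<subseteq> Poly_Mapping.keys m"
    proof
      assume "Poly_Mapping.keys m' \<subseteq> Poly_Mapping.keys m"
      then have "Poly_Mapping.keys m' = Poly_Mapping.keys m"
        using min[OF m'] by (simp add: card_subset_eq card_mono le_antisym)
      then have "m' = m"
        using lookup[OF m'] lookup[OF m] by (intro poly_mapping_eqI) simp
      with False show False ..
    qed
    then obtain i where i: "i \<in> Poly_Mapping.keys m'" "i \<notin> Poly_Mapping.keys m" by blast
    then have "x i ^ Poly_Mapping.lookup m' i = 0"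
      using lookup[OF m', of i] by (simp add: x_def)
    then show ?thesis
      using i False by (metis finite_keys prod_zero)
  qed
  then have "poly_value p x = (\<Sum>m' \<in> Poly_Mapping.keys p. Poly_Mapping.lookup p m' * (if m' = m then 1 else 0))"
    unfolding poly_value_def by (intro sum.cong) auto
  also have "\<dots> = Poly_Mapping.lookup p m"
    using m by (simp add: if_distrib sum.delta' cong: if_cong)
  finally show False
    using zero m by (simp add: in_keys_iff)
qed

section \<open>A multivariate Grace theorem and its analogue for identities\<close>

section \<open>Elimination of one variable at a time\<close>

locale affine_in_each_variable =
  fixes F :: "('j \<Rightarrow> complex) \<Rightarrow> complex"
  assumes affine: "F (y(k := t)) = F (y(k := 0)) + t * (F (y(k := 1)) - F (y(k := 0)))"

text \<open>If the sum vanished, then \<open>A + B t - (C + D t) w\<close>, the expansion of the sum in \<open>nz\<close>, would be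
  symmetric in \<open>t\<close> and \<open>w\<close>; its root \<open>w\<close> for a \<open>t\<close> on the circle lies in the open disc, and
  exchanging the two gives a contradiction. The condition \<open>inf\<close>, which says that \<open>w = \<infinity>\<close> is not
  a root, makes that root finite.\<close>

lemma grace_one_variable:
  fixes \<kappa> \<alpha> \<beta> u :: "'s \<Rightarrow> complex"
  assumes r: "r \<ge> 0"
    and nz: "\<And>t w. t \<in> cball p r \<Longrightarrow> w \<notin> ball p r \<Longrightarrow> (\<Sum>s\<in>I. \<kappa> s * (\<alpha> s + t * \<beta> s) * (u s - w)) \<noteq> 0"
    and inf: "\<And>t. t \<in> cball p r \<Longrightarrow> (\<Sum>s\<in>I. \<kappa> s * (\<alpha> s + t * \<beta> s)) \<noteq> 0"
  shows "(\<Sum>s\<in>I. \<kappa> s * (\<alpha> s + u s * \<beta> s)) \<noteq> 0"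
proof
  assume "(\<Sum>s\<in>I. \<kappa> s * (\<alpha> s + u s * \<beta> s)) = 0"
  define A B C D where "A = (\<Sum>s\<in>I. \<kappa> s * \<alpha> s * u s)" and "B = (\<Sum>s\<in>I. \<kappa> s * \<beta> s * u s)"
    and "C = (\<Sum>s\<in>I. \<kappa> s * \<alpha> s)" and "D = (\<Sum>s\<in>I. \<kappa> s * \<beta> s)"
  have "(\<Sum>s\<in>I. \<kappa> s * (\<alpha> s + u s * \<beta> s)) = C + B"
    unfolding B_def C_def sum.distrib[symmetric] by (intro sum.cong) (auto simp: algebra_simps)
  \<comment> \<open>\<open>C = - B\<close> is the condition that makes
    \<open>A + B t - (C + D t) w\<close> symmetric in \<open>t\<close> and \<open>w\<close>.\<close>
  with \<open>_ = 0\<close> have CB: "C = - B"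
    by (simp only: eq_neg_iff_add_eq_0)
  have inf': "(\<Sum>s\<in>I. \<kappa> s * (\<alpha> s + t * \<beta> s)) = C + D * t" for t
    unfolding C_def D_def sum_distrib_right sum.distrib[symmetric]
    by (intro sum.cong) (auto simp: algebra_simps)
  have nz': "(\<Sum>s\<in>I. \<kappa> s * (\<alpha> s + t * \<beta> s) * (u s - w)) = A + B * t - (C + D * t) * w" for t w
    unfolding A_def B_def C_def D_def sum_distrib_right sum.distrib[symmetric] sum_subtractf[symmetric]
    by (intro sum.cong) (auto simp: algebra_simps)
  \<comment> \<open>A boundary point lies in the closed disc but not in the open one, so it is
    admissible in both roles in \<open>nz\<close>.\<close>
  define t where "t = p + of_real r"
  have t: "t \<in> cball p r" "t \<notin> ball p r"
    using r by (auto simp: t_def dist_norm)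
  define w where "w = (A + B * t) / (C + D * t)"
  have "C + D * t \<noteq> 0"
    using inf[OF t(1)] by (simp add: inf')
  then have w: "A + B * t - (C + D * t) * w = 0"
    by (simp add: w_def)
  then have "w \<in> ball p r"
    using nz[OF t(1), of w] unfolding nz' by blast
  then have "w \<in> cball p r"
    by simp
  then have "A + B * w - (C + D * w) * t \<noteq> 0"
    using nz[OF _ t(2), of w] unfolding nz' by blast
  moreover have "A + B * w - (C + D * w) * t = A + B * t - (C + D * t) * w"
    by (simp add: CB algebra_simps)
  ultimately show False
    using w by simp
qed

text \<open>The point \<open>w = \<infinity>\<close> is represented by \<open>v = 0\<close>, \<open>w = -1\<close>, finite points by \<open>v = 1\<close>.\<close>

definition outside_disc :: "complex \<Rightarrow> real \<Rightarrow> complex \<Rightarrow> complex \<Rightarrow> bool" where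
  "outside_disc p r v w \<longleftrightarrow> v = 1 \<and> w \<notin> ball p r \<or> v = 0 \<and> w = -1"

context affine_in_each_variable
begin

text \<open>The state midway through an elimination: variables in \<open>J\<close> are already
  replaced by \<open>u\<close>, and the dependence on each remaining one is still affine.\<close>

lemma affine_mix:
  assumes "k \<notin> J"
  shows "F (\<lambda>j. if j \<in> J then u j else (y(k := t)) j) =
      F (\<lambda>j. if j \<in> J then u j else (y(k := 0)) j) +
      t * (F (\<lambda>j. if j \<in> J then u j else (y(k := 1)) j) - F (\<lambda>j. if j \<in> J then u j else (y(k := 0)) j))"
proof -
  have "(\<lambda>j. if j \<in> J then u j else (y(k := t)) j) = (\<lambda>j. if j \<in> J then u j else y j)(k := t)" for t
    using assms by auto
  then show ?thesis
    by (simp only: affine[of _ k t])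
qed

text \<open>Enlarging \<open>J\<close> by \<open>k\<close> amounts to evaluating the affine function
  of the free variable \<open>k\<close> at \<open>u k\<close>.\<close>

lemma affine_mix_insert:
  assumes "k \<notin> J"
  shows "F (\<lambda>j. if j \<in> insert k J then u j else y j) =
      F (\<lambda>j. if j \<in> J then u j else (y(k := 0)) j) +
      u k * (F (\<lambda>j. if j \<in> J then u j else (y(k := 1)) j) - F (\<lambda>j. if j \<in> J then u j else (y(k := 0)) j))"
proof -
  have "(\<lambda>j. if j \<in> insert k J then u j else y j) = (\<lambda>j. if j \<in> J then u j else (y(k := u k)) j)"
    using assms by auto
  then show ?thesis
    by (simp only: affine_mix[OF assms, of u y "u k"])
qed

text \<open>Induction on the set \<open>J\<close> of eliminated variables. At the start the sum is
  \<open>F y\<close> times the sum in \<open>G\<close>; each step replaces the free variable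
  \<open>k\<close> of \<open>F\<close> by \<open>u s k\<close>, which depends on \<open>s\<close>,
  and uses up the factor with index \<open>k\<close>. For \<open>J = N\<close> no factor is
  left.\<close>

theorem grace_multivariate:
  fixes u :: "'s \<Rightarrow> 'j \<Rightarrow> complex"
  assumes N: "finite N" and r: "r \<ge> 0"
    and F: "\<And>y. \<forall>j\<in>N. y j \<in> cball p r \<Longrightarrow> F y \<noteq> 0"
    and G: "\<And>v w. \<forall>j\<in>N. outside_disc p r (v j) (w j) \<Longrightarrow>
      (\<Sum>s\<in>I. c s * (\<Prod>j\<in>N. v j * u s j - w j)) \<noteq> 0"
  shows "(\<Sum>s\<in>I. c s * F (\<lambda>j. if j \<in> N then u s j else y j)) \<noteq> 0"
proof -
  have "\<forall>y v w. (\<forall>j\<in>N. y j \<in> cball p r) \<longrightarrow> (\<forall>j\<in>N. outside_disc p r (v j) (w j)) \<longrightarrow>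
      (\<Sum>s\<in>I. c s * F (\<lambda>j. if j \<in> J then u s j else y j) * (\<Prod>j\<in>N - J. v j * u s j - w j)) \<noteq> 0"
    if "finite J" "J \<subseteq> N" for J
    using that
  proof (induction J rule: finite_induct)
    case empty
    have "(\<Sum>s\<in>I. c s * F y * (\<Prod>j\<in>N. v j * u s j - w j)) =
        F y * (\<Sum>s\<in>I. c s * (\<Prod>j\<in>N. v j * u s j - w j))" for y v w
      by (simp add: sum_distrib_left mult_ac)
    then show ?case
      using F G by simp
  next
    case (insert k J)
    show ?case
    proof (intro allI impI)
      fix y v w
      assume y: "\<forall>j\<in>N. y j \<in> cball p r" and vw: "\<forall>j\<in>N. outside_disc p r (v j) (w j)"
      \<comment> \<open>With everything fixed except at \<open>k\<close>, \<open>\<kappa>\<close>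
        absorbs the other factors, and \<open>\<alpha>\<close> and \<open>\<beta>\<close> are the
        coefficients of \<open>F\<close> in the variable \<open>k\<close>.\<close>
      define \<kappa> where "\<kappa> s = c s * (\<Prod>j\<in>N - insert k J. v j * u s j - w j)" for s
      define \<alpha> \<beta> where "\<alpha> s = F (\<lambda>j. if j \<in> J then u s j else (y(k := 0)) j)"
        and "\<beta> s = F (\<lambda>j. if j \<in> J then u s j else (y(k := 1)) j) - \<alpha> s" for s
      have split: "N - J = insert k (N - insert k J)"
        using insert by auto
      have eq: "c s * F (\<lambda>j. if j \<in> J then u s j else (y(k := t)) j) *
          (\<Prod>j\<in>N - J. (v(k := v')) j * u s j - (w(k := w')) j) =
          \<kappa> s * (\<alpha> s + t * \<beta> s) * (v' * u s k - w')" for s t v' w'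
      proof -
        have "(\<Prod>j\<in>N - J. (v(k := v')) j * u s j - (w(k := w')) j) =
            (v' * u s k - w') * (\<Prod>j\<in>N - insert k J. v j * u s j - w j)"
          unfolding split using N by (subst prod.insert) (auto intro!: prod.cong)
        then show ?thesis
          using affine_mix[OF insert.hyps(2), of "u s" y t] by (simp add: \<kappa>_def \<alpha>_def \<beta>_def mult_ac)
      qed
      have IH: "(\<Sum>s\<in>I. \<kappa> s * (\<alpha> s + t * \<beta> s) * (v' * u s k - w')) \<noteq> 0"
        if "t \<in> cball p r" "outside_disc p r v' w'" for t v' w'
      proof -
        have "\<forall>j\<in>N. (y(k := t)) j \<in> cball p r"
          "\<forall>j\<in>N. outside_disc p r ((v(k := v')) j) ((w(k := w')) j)"
          using y vw that by auto
        moreover have "J \<subseteq> N"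
          using insert.prems by blast
        ultimately have "(\<Sum>s\<in>I. c s * F (\<lambda>j. if j \<in> J then u s j else (y(k := t)) j) *
            (\<Prod>j\<in>N - J. (v(k := v')) j * u s j - (w(k := w')) j)) \<noteq> 0"
          using insert.IH by blast
        then show ?thesis
          unfolding eq .
      qed
      have "(\<Sum>s\<in>I. \<kappa> s * (\<alpha> s + u s k * \<beta> s)) \<noteq> 0"
      proof (rule grace_one_variable[OF r])
        show "(\<Sum>s\<in>I. \<kappa> s * (\<alpha> s + t * \<beta> s) * (u s k - w')) \<noteq> 0"
          if "t \<in> cball p r" "w' \<notin> ball p r" for t w'
          using IH[of t 1 w'] that by (simp add: outside_disc_def)
        show "(\<Sum>s\<in>I. \<kappa> s * (\<alpha> s + t * \<beta> s)) \<noteq> 0" if "t \<in> cball p r" for t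
          \<comment> \<open>At infinity the factor with index \<open>k\<close> is
            \<open>0 * u s k + 1\<close> and drops out.\<close>
          using IH[of t 0 "-1"] that by (simp add: outside_disc_def)
      qed
      then show "(\<Sum>s\<in>I. c s * F (\<lambda>j. if j \<in> insert k J then u s j else y j) *
          (\<Prod>j\<in>N - insert k J. v j * u s j - w j)) \<noteq> 0"
        unfolding affine_mix_insert[OF insert.hyps(2)] \<kappa>_def \<beta>_def \<alpha>_def by (simp only: mult_ac not_False_eq_True)
    qed
  qed
  note eliminated = this[OF N subset_refl, rule_format]
  \<comment> \<open>The values of \<open>y\<close> on \<open>N\<close> are overwritten in the end,
    so they can be moved to the centre \<open>p\<close>, which satisfies the disc condition.\<close>
  let ?y = "\<lambda>j. if j \<in> N then p else y j"
  have "(\<Sum>s\<in>I. c s * F (\<lambda>j. if j \<in> N then u s j else ?y j) *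
      (\<Prod>j\<in>N - N. 0 * u s j - (-1))) \<noteq> 0"
    by (rule eliminated) (use r in \<open>auto simp: outside_disc_def\<close>)
  moreover have "(\<lambda>j. if j \<in> N then u s j else ?y j) = (\<lambda>j. if j \<in> N then u s j else y j)" for s
    by auto
  ultimately show ?thesis
    by (simp only: Diff_cancel prod.empty mult_1_right not_False_eq_True)
qed

text \<open>The same induction with identities in place of nonvanishing: a sum that is affine in
  \<open>w'\<close> and vanishes on the half-plane has both coefficients zero. For permutations this
  means that an operator killing all products of linear factors \<open>z_j + w_j\<close> with
  \<open>w_j\<close> in the upper half-plane kills every multiaffine polynomial.\<close>

theorem vanishing_on_products:
  fixes u :: "'s \<Rightarrow> 'j \<Rightarrow> complex"
  assumes N: "finite N"
    and G: "\<And>w. \<forall>j\<in>N. w j \<in> upper_half_plane \<Longrightarrow> (\<Sum>s\<in>I. c s * (\<Prod>j\<in>N. u s j + w j)) = 0"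
  shows "(\<Sum>s\<in>I. c s * F (\<lambda>j. if j \<in> N then u s j else y j)) = 0"
proof -
  have "\<forall>y w. (\<forall>j\<in>N. w j \<in> upper_half_plane) \<longrightarrow>
      (\<Sum>s\<in>I. c s * F (\<lambda>j. if j \<in> J then u s j else y j) * (\<Prod>j\<in>N - J. u s j + w j)) = 0"
    if "finite J" "J \<subseteq> N" for J
    using that
  proof (induction J rule: finite_induct)
    case empty
    have "(\<Sum>s\<in>I. c s * F y * (\<Prod>j\<in>N. u s j + w j)) =
        F y * (\<Sum>s\<in>I. c s * (\<Prod>j\<in>N. u s j + w j))" for y w
      by (simp add: sum_distrib_left mult_ac)
    then show ?case
      using G by simp
  next
    case (insert k J)
    show ?case
    proof (intro allI impI)
      fix y w
      assume w: "\<forall>j\<in>N. w j \<in> upper_half_plane"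
      define \<kappa> where "\<kappa> s = c s * (\<Prod>j\<in>N - insert k J. u s j + w j)" for s
      define \<alpha> \<beta> where "\<alpha> s = F (\<lambda>j. if j \<in> J then u s j else (y(k := 0)) j)"
        and "\<beta> s = F (\<lambda>j. if j \<in> J then u s j else (y(k := 1)) j) - \<alpha> s" for s
      have split: "N - J = insert k (N - insert k J)"
        using insert by auto
      have eq: "c s * F (\<lambda>j. if j \<in> J then u s j else (y(k := t)) j) *
          (\<Prod>j\<in>N - J. u s j + (w(k := w')) j) = \<kappa> s * (\<alpha> s + t * \<beta> s) * (u s k + w')" for s t w'
      proof -
        have "(\<Prod>j\<in>N - J. u s j + (w(k := w')) j) =
            (u s k + w') * (\<Prod>j\<in>N - insert k J. u s j + w j)"
          unfolding split using N by (subst prod.insert) (auto intro!: prod.cong)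
        then show ?thesis
          using affine_mix[OF insert.hyps(2), of "u s" y t] by (simp add: \<kappa>_def \<alpha>_def \<beta>_def mult_ac)
      qed
      have IH: "(\<Sum>s\<in>I. \<kappa> s * (\<alpha> s + t * \<beta> s) * (u s k + w')) = 0"
        if "w' \<in> upper_half_plane" for t w'
      proof -
        have "\<forall>j\<in>N. (w(k := w')) j \<in> upper_half_plane"
          using w that by auto
        then show ?thesis
          using insert.IH insert.prems unfolding eq[symmetric] by blast
      qed
      \<comment> \<open>Two points with difference 1: subtracting the values at them leaves the
        coefficient of \<open>w'\<close>.\<close>
      have H: "\<i> \<in> upper_half_plane" "\<i> + 1 \<in> upper_half_plane"
        by (auto simp: upper_half_plane_def)
      have E: "(\<Sum>s\<in>I. \<kappa> s * (\<alpha> s + t * \<beta> s)) = 0" for t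
      proof -
        have "(\<Sum>s\<in>I. \<kappa> s * (\<alpha> s + t * \<beta> s)) =
            (\<Sum>s\<in>I. \<kappa> s * (\<alpha> s + t * \<beta> s) * (u s k + (\<i> + 1)) - \<kappa> s * (\<alpha> s + t * \<beta> s) * (u s k + \<i>))"
          by (intro sum.cong) (auto simp: algebra_simps)
        also have "\<dots> = 0"
          unfolding sum_subtractf IH[OF H(1)] IH[OF H(2)] by simp
        finally show ?thesis .
      qed
      have E': "(\<Sum>s\<in>I. \<kappa> s * (\<alpha> s + t * \<beta> s) * u s k) = 0" for t
      proof -
        have "(\<Sum>s\<in>I. \<kappa> s * (\<alpha> s + t * \<beta> s) * u s k) =
            (\<Sum>s\<in>I. \<kappa> s * (\<alpha> s + t * \<beta> s) * (u s k + \<i>)) - \<i> * (\<Sum>s\<in>I. \<kappa> s * (\<alpha> s + t * \<beta> s))"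
          by (simp add: sum_distrib_left algebra_simps flip: sum_subtractf)
        also have "\<dots> = 0"
          unfolding IH[OF H(1)] E by simp
        finally show ?thesis .
      qed
      \<comment> \<open>The slopes \<open>\<beta> s\<close> arise as the difference between
        \<open>t = 1\<close> and \<open>t = 0\<close>, so the sum is a combination of instances of
        \<open>E\<close> and \<open>E'\<close>.\<close>
      have "(\<Sum>s\<in>I. \<kappa> s * (\<alpha> s + u s k * \<beta> s)) =
          (\<Sum>s\<in>I. \<kappa> s * (\<alpha> s + 0 * \<beta> s) + (\<kappa> s * (\<alpha> s + 1 * \<beta> s) * u s k - \<kappa> s * (\<alpha> s + 0 * \<beta> s) * u s k))"
        by (intro sum.cong) (auto simp: algebra_simps)
      also have "\<dots> = 0"
        unfolding sum.distrib sum_subtractf E E' by simp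
      finally show "(\<Sum>s\<in>I. c s * F (\<lambda>j. if j \<in> insert k J then u s j else y j) *
          (\<Prod>j\<in>N - insert k J. u s j + w j)) = 0"
        unfolding affine_mix_insert[OF insert.hyps(2)] \<kappa>_def \<beta>_def \<alpha>_def by (simp add: mult_ac)
    qed
  qed
  from this[OF N subset_refl, rule_format, of "\<lambda>_. \<i>" y] show ?thesis
    by (simp add: upper_half_plane_def)
qed

end

lemma affine_in_each_variable_poly_value:
  "multiaffine p \<Longrightarrow> affine_in_each_variable (poly_value p)"
  by unfold_locales (rule poly_value_affine)

section \<open>Moebius invariance of nonvanishing for separated points\<close>

section \<open>Moebius transformations\<close>

text \<open>The middle term of all the equivalences: nonvanishing of the difference polynomial when
  the real line separates, with the \<open>z j\<close> above it.\<close>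

definition half_plane_stable :: "nat \<Rightarrow> ((nat \<Rightarrow> nat) \<Rightarrow> complex) \<Rightarrow> bool" where
  "half_plane_stable n c \<longleftrightarrow>
     (\<forall>z w. (\<forall>j\<in>{1..n}. Im (z j) > 0 \<and> Im (w j) < 0) \<longrightarrow>
       (\<Sum>\<sigma> | \<sigma> permutes {1..n}. c \<sigma> * (\<Prod>j=1..n. z (\<sigma> j) - w j)) \<noteq> 0)"

text \<open>Replacing \<open>w j\<close> by \<open>- w j\<close> exchanges the half-planes and turns
  sums into differences.\<close>

lemma stable_sum_poly_iff: "stable_poly (zw_vars n) (sum_poly n c) \<longleftrightarrow> half_plane_stable n c"
proof
  assume st: "stable_poly (zw_vars n) (sum_poly n c)"
  show "half_plane_stable n c"
    unfolding half_plane_stable_def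
  proof (intro allI impI)
    fix z w :: "nat \<Rightarrow> complex"
    assume zw: "\<forall>j\<in>{1..n}. Im (z j) > 0 \<and> Im (w j) < 0"
    have "\<forall>i\<in>zw_vars n. case_sum z (\<lambda>j. - w j) i \<in> upper_half_plane"
      using zw by (auto simp: zw_vars_def upper_half_plane_def)
    then have "poly_value (sum_poly n c) (case_sum z (\<lambda>j. - w j)) \<noteq> 0"
      using st unfolding stable_poly_def by blast
    then show "(\<Sum>\<sigma> | \<sigma> permutes {1..n}. c \<sigma> * (\<Prod>j=1..n. z (\<sigma> j) - w j)) \<noteq> 0"
      by (simp add: sum_poly_def)
  qed
next
  assume st: "half_plane_stable n c"
  show "stable_poly (zw_vars n) (sum_poly n c)"
    unfolding stable_poly_def
  proof (intro conjI allI impI)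
    show "sum_poly n c \<in> polys_in (zw_vars n)"
      using multiaffine_in_sum_difference_poly by (auto simp: multiaffine_in_def)
    fix x assume x: "\<forall>i\<in>zw_vars n. x i \<in> upper_half_plane"
    have "\<forall>j\<in>{1..n}. Im (x (Inl j)) > 0 \<and> Im (- x (Inr j)) < 0"
      using x by (auto simp: zw_vars_def upper_half_plane_def)
    then have "(\<Sum>\<sigma> | \<sigma> permutes {1..n}. c \<sigma> * (\<Prod>j=1..n. x (Inl (\<sigma> j)) - - x (Inr j))) \<noteq> 0"
      using st[unfolded half_plane_stable_def, rule_format,
          of "\<lambda>j. x (Inl j)" "\<lambda>j. - x (Inr j)"] by blast
    then show "poly_value (sum_poly n c) x \<noteq> 0"
      by (simp add: sum_poly_def)
  qed
qed

text \<open>The Moebius transformation \<open>(a z + b) / (g z + d)\<close> acts on the point \<open>w / v\<close> of the Riemann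
  sphere; the difference of two images is \<open>(a d - b g) (v z - w)\<close> up to a factor that splits.\<close>

lemma moebius_nonzero:
  assumes st: "half_plane_stable n c"
    and z: "\<And>j. j \<in> {1..n} \<Longrightarrow> g * z j + d \<noteq> 0 \<and> Im ((a * z j + b) / (g * z j + d)) > 0"
    and w: "\<And>j. j \<in> {1..n} \<Longrightarrow>
      g * w j + d * v j \<noteq> 0 \<and> Im ((a * w j + b * v j) / (g * w j + d * v j)) < 0"
  shows "(\<Sum>\<sigma> | \<sigma> permutes {1..n}. c \<sigma> * (\<Prod>j=1..n. v j * z (\<sigma> j) - w j)) \<noteq> 0"
proof
  assume zero: "(\<Sum>\<sigma> | \<sigma> permutes {1..n}. c \<sigma> * (\<Prod>j=1..n. v j * z (\<sigma> j) - w j)) = 0"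
  define Z W where "Z j = (a * z j + b) / (g * z j + d)"
    and "W j = (a * w j + b * v j) / (g * w j + d * v j)" for j
  \<comment> \<open>The same factor for all permutations: \<open>w\<close> and \<open>v\<close> are
    indexed by \<open>j\<close> itself, and the product over \<open>z\<close> is only reordered by
    \<open>\<sigma>\<close>.\<close>
  define \<rho> where "\<rho> = (\<Prod>j=1..n. (a * d - b * g) / (g * w j + d * v j)) / (\<Prod>j=1..n. g * z j + d)"
  have "(\<Prod>j=1..n. Z (\<sigma> j) - W j) = \<rho> * (\<Prod>j=1..n. v j * z (\<sigma> j) - w j)"
    if \<sigma>: "\<sigma> permutes {1..n}" for \<sigma>
  proof -
    have "Z (\<sigma> j) - W j = (a * d - b * g) / (g * w j + d * v j) / (g * z (\<sigma> j) + d) * (v j * z (\<sigma> j) - w j)"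
      if j: "j \<in> {1..n}" for j
    proof -
      have "\<sigma> j \<in> {1..n}"
        using permutes_in_image[OF \<sigma>] j by blast
      then have "g * z (\<sigma> j) + d \<noteq> 0" "g * w j + d * v j \<noteq> 0"
        using z w j by blast+
      then show ?thesis
        unfolding Z_def W_def by (simp add: divide_simps) (simp add: algebra_simps)
    qed
    then have "(\<Prod>j=1..n. Z (\<sigma> j) - W j) =
        (\<Prod>j=1..n. (a * d - b * g) / (g * w j + d * v j)) / (\<Prod>j=1..n. g * z (\<sigma> j) + d) *
        (\<Prod>j=1..n. v j * z (\<sigma> j) - w j)"
      by (simp add: prod.distrib prod_dividef)
    also have "(\<Prod>j=1..n. g * z (\<sigma> j) + d) = (\<Prod>j=1..n. g * z j + d)"
      using prod.permute[OF \<sigma>, of "\<lambda>j. g * z j + d"] by (simp add: o_def)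
    finally show ?thesis
      by (simp add: \<rho>_def)
  qed
  then have "(\<Sum>\<sigma> | \<sigma> permutes {1..n}. c \<sigma> * (\<Prod>j=1..n. Z (\<sigma> j) - W j)) =
      \<rho> * (\<Sum>\<sigma> | \<sigma> permutes {1..n}. c \<sigma> * (\<Prod>j=1..n. v j * z (\<sigma> j) - w j))"
    by (simp add: sum_distrib_left mult_ac)
  also have "\<dots> = 0"
    using zero by simp
  finally have "(\<Sum>\<sigma> | \<sigma> permutes {1..n}. c \<sigma> * (\<Prod>j=1..n. Z (\<sigma> j) - W j)) = 0" .
  moreover have "\<forall>j\<in>{1..n}. Im (Z j) > 0 \<and> Im (W j) < 0"
    using z w by (simp add: Z_def W_def)
  ultimately show False
    using st[unfolded half_plane_stable_def, rule_format, of Z W] by metis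
qed

text \<open>For \<open>r > 0\<close> this Cayley map sends the disc of radius \<open>r\<close> about
  0 to the upper half-plane and its exterior to the lower one, as the sign of the numerator shows.
  At the pole \<open>u = r\<close> both sides are 0 by the convention for division.\<close>

lemma Im_cayley:
  fixes u :: complex and r :: real
  shows "Im (\<i> * (r + u) / (r - u)) = (r\<^sup>2 - (cmod u)\<^sup>2) / (cmod (r - u))\<^sup>2"
  unfolding Im_divide cmod_power2
  by (simp add: power2_eq_square algebra_simps)

lemma of_real_minus_ne:
  fixes u :: complex
  assumes "r > 0" "cmod u < r \<or> cmod u > r"
  shows "of_real r - u \<noteq> 0"
proof
  assume "of_real r - u = 0"
  then have "u = of_real r" by simp
  then show False
    using assms by simp
qed

lemma inside_disc_nonzero:
  assumes st: "half_plane_stable n c"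
    and z: "\<And>j. j \<in> {1..n} \<Longrightarrow> z j \<in> ball p r"
    and w: "\<And>j. j \<in> {1..n} \<Longrightarrow> v j = 1 \<and> w j \<notin> cball p r \<or> v j = 0 \<and> w j = -1"
  shows "(\<Sum>\<sigma> | \<sigma> permutes {1..n}. c \<sigma> * (\<Prod>j=1..n. v j * z (\<sigma> j) - w j)) \<noteq> 0"
\<comment> \<open>The coefficients of the Cayley map for the disc about \<open>p\<close>, that is
  \<open>\<i> (r + (x - p)) / (r - (x - p))\<close>.\<close>
proof (rule moebius_nonzero[OF st, where a = \<i> and b = "\<i> * (r - p)" and g = "-1" and d = "r + p"])
  fix j assume j: "j \<in> {1..n}"
  have r: "r > 0"
    using z[OF j] by (metis ball_eq_empty empty_iff linorder_not_le)
  have zj: "cmod (z j - p) < r"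
    using z[OF j] by (simp add: dist_norm norm_minus_commute)
  then have ne: "complex_of_real r - (z j - p) \<noteq> 0"
    using r of_real_minus_ne by blast
  have "0 < r\<^sup>2 - (cmod (z j - p))\<^sup>2"
    using zj by (simp add: power_strict_mono)
  then have "Im (\<i> * (r + (z j - p)) / (r - (z j - p))) > 0"
    unfolding Im_cayley using ne by (intro divide_pos_pos) auto
  with ne show "- 1 * z j + (r + p) \<noteq> 0 \<and> 0 < Im ((\<i> * z j + \<i> * (r - p)) / (- 1 * z j + (r + p)))"
    by (simp add: algebra_simps)
  show "- 1 * w j + (r + p) * v j \<noteq> 0 \<and>
      Im ((\<i> * w j + \<i> * (r - p) * v j) / (- 1 * w j + (r + p) * v j)) < 0"
    using w[OF j]
  proof
    assume vw: "v j = 1 \<and> w j \<notin> cball p r"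
    then have wj: "cmod (w j - p) > r"
      by (simp add: dist_norm norm_minus_commute)
    then have ne: "complex_of_real r - (w j - p) \<noteq> 0"
      using r of_real_minus_ne by blast
    have "r\<^sup>2 - (cmod (w j - p))\<^sup>2 < 0"
      using wj r by (simp add: power_strict_mono)
    then have "Im (\<i> * (r + (w j - p)) / (r - (w j - p))) < 0"
      unfolding Im_cayley using ne by (intro divide_neg_pos) auto
    with ne vw show ?thesis
      by (simp add: algebra_simps)
  next
    \<comment> \<open>The point at infinity is sent to \<open>-\<i>\<close>.\<close>
    assume "v j = 0 \<and> w j = -1"
    then show ?thesis by simp
  qed
qed

text \<open>The negative of the Cayley map sends the exterior to the upper half-plane and the disc
  to the lower one.\<close>

lemma outside_disc_nonzero:
  assumes st: "half_plane_stable n c"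
    and z: "\<And>j. j \<in> {1..n} \<Longrightarrow> z j \<notin> cball p r"
    and w: "\<And>j. j \<in> {1..n} \<Longrightarrow> w j \<in> ball p r"
  shows "(\<Sum>\<sigma> | \<sigma> permutes {1..n}. c \<sigma> * (\<Prod>j=1..n. z (\<sigma> j) - w j)) \<noteq> 0"
proof -
  have "(\<Sum>\<sigma> | \<sigma> permutes {1..n}. c \<sigma> * (\<Prod>j=1..n. (\<lambda>_. 1) j * z (\<sigma> j) - w j)) \<noteq> 0"
  proof (rule moebius_nonzero[OF st, where a = "-\<i>" and b = "-\<i> * (r - p)" and g = "-1" and d = "r + p"])
    fix j assume j: "j \<in> {1..n}"
    have r: "r > 0"
      using w[OF j] by (metis ball_eq_empty empty_iff linorder_not_le)
    have zj: "cmod (z j - p) > r" and wj: "cmod (w j - p) < r"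
      using z[OF j] w[OF j] by (simp_all add: dist_norm norm_minus_commute)
    have ne: "complex_of_real r - (z j - p) \<noteq> 0" "complex_of_real r - (w j - p) \<noteq> 0"
      using r zj wj of_real_minus_ne by blast+
    have "r\<^sup>2 - (cmod (z j - p))\<^sup>2 < 0" "0 < r\<^sup>2 - (cmod (w j - p))\<^sup>2"
      using zj wj r by (simp_all add: power_strict_mono)
    then have im: "Im (\<i> * (r + (z j - p)) / (r - (z j - p))) < 0"
      "Im (\<i> * (r + (w j - p)) / (r - (w j - p))) > 0"
      unfolding Im_cayley using ne by (auto intro!: divide_pos_pos divide_neg_pos)
    have neg: "(-\<i> * x + -\<i> * (r - p)) / (-1 * x + (r + p)) = - (\<i> * (r + (x - p)) / (r - (x - p)))" for x
    proof -
      have "-\<i> * x + -\<i> * (r - p) = - (\<i> * (r + (x - p)))" "-1 * x + (r + p) = r - (x - p)"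
        by (simp_all add: algebra_simps)
      then show ?thesis
        by (simp only: minus_divide_left)
    qed
    show "- 1 * z j + (r + p) \<noteq> 0 \<and> 0 < Im ((- \<i> * z j + - \<i> * (r - p)) / (- 1 * z j + (r + p)))"
      unfolding neg using im ne by (simp add: algebra_simps)
    show "- 1 * w j + (r + p) * 1 \<noteq> 0 \<and>
        Im ((- \<i> * w j + - \<i> * (r - p) * 1) / (- 1 * w j + (r + p) * 1)) < 0"
      unfolding mult_1_right neg using im ne by (simp add: algebra_simps)
  qed
  then show ?thesis by simp
qed

text \<open>The affine map taking \<open>x\<close> to \<open>\<i> * cnj a * x - \<i> * b\<close> has
  imaginary part \<open>a \<bullet> x - b\<close>.\<close>

lemma half_planes_nonzero:
  assumes st: "half_plane_stable n c"
    and z: "\<And>j. j \<in> {1..n} \<Longrightarrow> a \<bullet> z j > b"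
    and w: "\<And>j. j \<in> {1..n} \<Longrightarrow> a \<bullet> w j < b"
  shows "(\<Sum>\<sigma> | \<sigma> permutes {1..n}. c \<sigma> * (\<Prod>j=1..n. z (\<sigma> j) - w j)) \<noteq> 0"
proof -
  have "(\<Sum>\<sigma> | \<sigma> permutes {1..n}. c \<sigma> * (\<Prod>j=1..n. (\<lambda>_. 1) j * z (\<sigma> j) - w j)) \<noteq> 0"
    by (rule moebius_nonzero[OF st, where a = "\<i> * cnj a" and b = "-\<i> * b" and g = 0 and d = 1])
      (use z w in \<open>auto simp: inner_complex_def algebra_simps\<close>)
  then show ?thesis by simp
qed

section \<open>Separating circles and lines, and the Grace-like property\<close>

section \<open>Circles and lines\<close>

text \<open>A connected piece that meets a component is contained in it. So \<open>A\<close>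
  contains one piece, and \<open>B\<close>, being disjoint from \<open>A\<close>, lies in the other
  piece and contains it.\<close>

lemma components_of_two_pieces:
  assumes "connected U" "connected V" "S = U \<union> V"
    and "A \<in> components S" "B \<in> components S" "A \<noteq> B"
  shows "A \<subseteq> U \<and> B \<subseteq> V \<or> A \<subseteq> V \<and> B \<subseteq> U"
proof -
  have disj: "A \<inter> B = {}"
    using assms(4-6) components_nonoverlap by blast
  have sub: "A \<subseteq> U \<union> V" "B \<subseteq> U \<union> V"
    using assms(3-5) in_components_subset by blast+
  have piece: "C \<inter> T = {} \<or> T \<subseteq> C"
    if "C \<in> components S" "connected T" "T \<subseteq> S" for C T
    using components_maximal[OF that] by blast
  have "U \<subseteq> S" "V \<subseteq> S"
    using assms(3) by auto
  note pieces = piece[OF assms(4,1) \<open>U \<subseteq> S\<close>] piece[OF assms(4,2) \<open>V \<subseteq> S\<close>]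
    piece[OF assms(5,1) \<open>U \<subseteq> S\<close>] piece[OF assms(5,2) \<open>V \<subseteq> S\<close>]
  obtain x y where x: "x \<in> A" and y: "y \<in> B"
    using assms(4,5) in_components_nonempty by blast
  consider "x \<in> U" | "x \<in> V"
    using x sub by blast
  then show ?thesis
  proof cases
    case 1
    then have "U \<subseteq> A" using x pieces by blast
    then have "y \<in> V" "B \<subseteq> V" using y sub disj by blast+
    then have "V \<subseteq> B" using y pieces by blast
    then show ?thesis using \<open>B \<subseteq> V\<close> sub disj by blast
  next
    case 2
    then have "V \<subseteq> A" using x pieces by blast
    then have "y \<in> U" "B \<subseteq> U" using y sub disj by blast+
    then have "U \<subseteq> B" using y pieces by blast
    then show ?thesis using \<open>B \<subseteq> U\<close> sub disj by blast
  qed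
qed

lemma separated_by_circle_nonzero:
  assumes st: "half_plane_stable n c"
    and sep: "separated_by_circle (z ` {1..n}) (w ` {1..n})"
  shows "(\<Sum>\<sigma> | \<sigma> permutes {1..n}. c \<sigma> * (\<Prod>j=1..n. z (\<sigma> j) - w j)) \<noteq> 0"
proof -
  obtain C A B where C: "circle_or_line C" and A: "A \<in> components (- C)"
    and B: "B \<in> components (- C)" "A \<noteq> B" and sub: "z ` {1..n} \<subseteq> A" "w ` {1..n} \<subseteq> B"
    using sep unfolding separated_by_circle_def by blast
  from C consider (circle) p r where "r > 0" "C = sphere p r"
    | (line) a b where "a \<noteq> 0" "C = {x. a \<bullet> x = b}"
    unfolding circle_or_line_def by blast
  then show ?thesis
  proof cases
    case (circle p r)
    \<comment> \<open>The exterior is connected as the complement of a bounded convex set in the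
      plane.\<close>
    have "connected (ball p r)" "connected (- cball p r)" "- C = ball p r \<union> - cball p r"
      using circle by (auto intro!: connected_complement_bounded_convex)
    from components_of_two_pieces[OF this A B] show ?thesis
    proof
      assume "A \<subseteq> ball p r \<and> B \<subseteq> - cball p r"
      then have "\<And>j. j \<in> {1..n} \<Longrightarrow> z j \<in> ball p r" "\<And>j. j \<in> {1..n} \<Longrightarrow> w j \<notin> cball p r"
        using sub by blast+
      then show ?thesis
        using inside_disc_nonzero[OF st, of z p r "\<lambda>_. 1" w] by simp
    next
      assume "A \<subseteq> - cball p r \<and> B \<subseteq> ball p r"
      then have "\<And>j. j \<in> {1..n} \<Longrightarrow> z j \<notin> cball p r" "\<And>j. j \<in> {1..n} \<Longrightarrow> w j \<in> ball p r"
        using sub by blast+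
      then show ?thesis
        by (rule outside_disc_nonzero[OF st])
    qed
  next
    case (line a b)
    have "connected {x. a \<bullet> x < b}" "connected {x. a \<bullet> x > b}"
      by (auto intro!: convex_connected convex_halfspace_lt convex_halfspace_gt)
    moreover have "- C = {x. a \<bullet> x < b} \<union> {x. a \<bullet> x > b}"
      using line by auto
    ultimately have "A \<subseteq> {x. a \<bullet> x < b} \<and> B \<subseteq> {x. a \<bullet> x > b} \<or>
        A \<subseteq> {x. a \<bullet> x > b} \<and> B \<subseteq> {x. a \<bullet> x < b}"
      using A B by (rule components_of_two_pieces)
    then show ?thesis
    proof
      assume "A \<subseteq> {x. a \<bullet> x < b} \<and> B \<subseteq> {x. a \<bullet> x > b}"
      \<comment> \<open>Negating the normal vector exchanges the two sides of the line.\<close>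
      then have "\<And>j. j \<in> {1..n} \<Longrightarrow> -a \<bullet> z j > -b" "\<And>j. j \<in> {1..n} \<Longrightarrow> -a \<bullet> w j < -b"
        using sub by (auto simp: image_subset_iff subset_iff)
      then show ?thesis
        by (rule half_planes_nonzero[OF st])
    next
      assume "A \<subseteq> {x. a \<bullet> x > b} \<and> B \<subseteq> {x. a \<bullet> x < b}"
      then have "\<And>j. j \<in> {1..n} \<Longrightarrow> a \<bullet> z j > b" "\<And>j. j \<in> {1..n} \<Longrightarrow> a \<bullet> w j < b"
        using sub by (auto simp: image_subset_iff subset_iff)
      then show ?thesis
        by (rule half_planes_nonzero[OF st])
    qed
  qed
qed

text \<open>Each half-plane lies in the component of \<open>\<i>\<close> or of \<open>-\<i>\<close>,
  and these differ because a connected set containing both points meets the line.\<close>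

lemma separated_by_real_line:
  assumes "\<And>z. z \<in> Z \<Longrightarrow> Im z > 0" and "\<And>w. w \<in> W \<Longrightarrow> Im w < 0"
  shows "separated_by_circle Z W"
proof -
  define C where "C = {x. \<i> \<bullet> x = 0}"
  have Im: "\<i> \<bullet> x = Im x" for x
    by (simp add: inner_complex_def)
  have C: "circle_or_line C"
    unfolding circle_or_line_def C_def
    by (intro disjI2 exI[of _ \<i>] exI[of _ "0::real"] conjI) simp_all
  have upper: "connected {x. \<i> \<bullet> x > 0}" "{x. \<i> \<bullet> x > 0} \<subseteq> - C" "\<i> \<in> {x. \<i> \<bullet> x > 0}"
    by (rule convex_connected[OF convex_halfspace_gt]) (auto simp: C_def Im)
  have lower: "connected {x. \<i> \<bullet> x < 0}" "{x. \<i> \<bullet> x < 0} \<subseteq> - C" "-\<i> \<in> {x. \<i> \<bullet> x < 0}"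
    by (rule convex_connected[OF convex_halfspace_lt]) (auto simp: C_def Im)
  have sub: "{x. \<i> \<bullet> x > 0} \<subseteq> connected_component_set (- C) \<i>"
    "{x. \<i> \<bullet> x < 0} \<subseteq> connected_component_set (- C) (-\<i>)"
    using connected_component_maximal[OF upper(3,1,2)] connected_component_maximal[OF lower(3,1,2)] .
  have comp: "connected_component_set (- C) \<i> \<in> components (- C)"
      "connected_component_set (- C) (-\<i>) \<in> components (- C)"
    using componentsI[OF subsetD[OF upper(2,3)]] componentsI[OF subsetD[OF lower(2,3)]] .
  have "connected_component_set (- C) \<i> \<noteq> connected_component_set (- C) (-\<i>)"
  proof
    let ?S = "connected_component_set (- C) \<i>"
    assume "?S = connected_component_set (- C) (-\<i>)"
    then have "\<i> \<in> ?S" "-\<i> \<in> ?S"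
      using subsetD[OF sub(1) upper(3)] subsetD[OF sub(2) lower(3)] by simp_all
    then have "\<exists>x\<in>?S. \<i> \<bullet> x = 0"
      by (intro connected_ivt_hyperplane[where x = "-\<i>" and y = \<i>]) (auto simp: Im)
    then obtain x where "x \<in> ?S" "x \<in> C"
      by (auto simp: C_def)
    then show False
      using connected_component_subset[of "- C" \<i>] by blast
  qed
  moreover have "Z \<subseteq> {x. \<i> \<bullet> x > 0}" "W \<subseteq> {x. \<i> \<bullet> x < 0}"
    using assms by (auto simp: Im)
  then have "Z \<subseteq> connected_component_set (- C) \<i>" "W \<subseteq> connected_component_set (- C) (-\<i>)"
    using sub by (meson order_trans)+
  ultimately show ?thesis
    unfolding separated_by_circle_def using C comp by (intro exI conjI)
qed

lemma poly_value_difference_poly: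
  "poly_value (difference_poly n c) (case_sum z w) =
     (\<Sum>\<sigma> | \<sigma> permutes {1..n}. c \<sigma> * (\<Prod>j=1..n. z (\<sigma> j) - w j))"
  by (simp add: difference_poly_def)

text \<open>The real line is one of the separating curves, and Moebius invariance covers all the
  others.\<close>

lemma grace_like_iff: "grace_like n (difference_poly n c) \<longleftrightarrow> half_plane_stable n c"
proof
  assume gr: "grace_like n (difference_poly n c)"
  show "half_plane_stable n c"
    unfolding half_plane_stable_def
  proof (intro allI impI)
    fix z w :: "nat \<Rightarrow> complex"
    assume "\<forall>j\<in>{1..n}. Im (z j) > 0 \<and> Im (w j) < 0"
    then have "separated_by_circle (z ` {1..n}) (w ` {1..n})"
      by (intro separated_by_real_line) auto
    then show "(\<Sum>\<sigma> | \<sigma> permutes {1..n}. c \<sigma> * (\<Prod>j=1..n. z (\<sigma> j) - w j)) \<noteq> 0"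
      using gr unfolding grace_like_def poly_value_difference_poly by blast
  qed
next
  assume "half_plane_stable n c"
  then show "grace_like n (difference_poly n c)"
    using multiaffine_in_sum_difference_poly(2)[of n c] separated_by_circle_nonzero
    unfolding grace_like_def poly_value_difference_poly multiaffine_in_def by blast
qed

section \<open>The equivalence with stability preservation\<close>

section \<open>Stability preservation\<close>

text \<open>Discs about \<open>\<i> * R\<close> of radius slightly below \<open>R\<close> fill the
  half-plane as \<open>R\<close> grows. Two radii are provided because \<open>outside_disc\<close>
  admits points on the circle of radius \<open>r\<close>, while \<open>inside_disc_nonzero\<close>
  wants finite outer points off the closed disc; radius \<open>s < r\<close> achieves this.\<close>

lemma disc_in_upper_half_plane:
  assumes "finite Z" and Z: "\<And>z. z \<in> Z \<Longrightarrow> Im z > 0"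
  obtains p s r where "0 \<le> s" "s < r" "Z \<subseteq> ball p s" "cball p r \<subseteq> upper_half_plane"
proof -
  obtain e where e: "e > 0" "\<And>z. z \<in> Z \<Longrightarrow> 3 * e \<le> Im z"
  proof
    \<comment> \<open>The element 1 keeps the minimum defined for empty \<open>Z\<close>.\<close>
    show "Min (insert 1 (Im ` Z)) / 3 > 0"
      using assms by simp
    show "3 * (Min (insert 1 (Im ` Z)) / 3) \<le> Im z" if "z \<in> Z" for z
      using assms that by simp
  qed
  obtain M where M: "\<And>z. z \<in> Z \<Longrightarrow> cmod z \<le> M"
    using finite_imp_bounded[OF assms(1)] unfolding bounded_iff by blast
  \<comment> \<open>For \<open>z\<close> in \<open>Z\<close> the squared distance to
    \<open>\<i> * R\<close> is at most \<open>M\<^sup>2 - 6 * R * e + R\<^sup>2\<close>, which is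
    below \<open>(R - 2 * e)\<^sup>2\<close> once \<open>2 * R * e > M\<^sup>2\<close>.\<close>
  define R where "R = M\<^sup>2 / e + 2 * e"
  have R: "R \<ge> 2 * e" and Re: "2 * R * e > M\<^sup>2"
  proof -
    have "2 * R * e = 2 * M\<^sup>2 + 4 * (e * e)"
      using e(1) by (simp add: R_def field_simps)
    moreover have "e * e > 0" "M\<^sup>2 \<ge> 0"
      using e(1) by simp_all
    ultimately show "2 * R * e > M\<^sup>2"
      by linarith
  qed (use e(1) in \<open>simp add: R_def\<close>)
  show ?thesis
  proof
    show "0 \<le> R - 2 * e" "R - 2 * e < R - e"
      using R e by auto
    show "Z \<subseteq> ball (\<i> * R) (R - 2 * e)"
    proof
      fix z assume z: "z \<in> Z"
      have "(cmod z)\<^sup>2 \<le> M\<^sup>2"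
        using M[OF z] by (intro power_mono) auto
      moreover have "R * (2 * (3 * e)) \<le> R * (2 * Im z)"
        using e(2)[OF z] R e(1) by (intro mult_left_mono) auto
      moreover have "(cmod (\<i> * R - z))\<^sup>2 = (cmod z)\<^sup>2 - R * (2 * Im z) + R\<^sup>2"
        unfolding cmod_power2 by (simp add: power2_eq_square algebra_simps)
      moreover have "e * e > 0"
        using e by simp
      ultimately have "(cmod (\<i> * R - z))\<^sup>2 < (R - 2 * e)\<^sup>2"
        using Re unfolding power2_eq_square by (simp add: algebra_simps)
      then show "z \<in> ball (\<i> * R) (R - 2 * e)"
        using R by (auto simp: dist_norm intro: power2_less_imp_less)
    qed
    show "cball (\<i> * R) (R - e) \<subseteq> upper_half_plane"
    proof
      fix z assume "z \<in> cball (\<i> * R) (R - e)"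
      then have "\<bar>Im (\<i> * R - z)\<bar> \<le> R - e"
        using abs_Im_le_cmod[of "\<i> * R - z"] by (simp add: dist_norm)
      then show "z \<in> upper_half_plane"
        using e(1) by (simp add: upper_half_plane_def)
    qed
  qed
qed

lemma preserves_stability_if_half_plane_stable:
  assumes st: "half_plane_stable n c"
  shows "preserves_stability n (perm_operator n c)"
  unfolding preserves_stability_def
\<comment> \<open>In this direction the image of a stable polynomial is always stable, never
  zero.\<close>
proof (intro ballI impI disjI1)
  fix f assume f: "f \<in> multiaffine_space n" and fst: "stable_poly {1..n} f"
  interpret affine_in_each_variable "poly_value f"
    using f by (intro affine_in_each_variable_poly_value) (simp add: multiaffine_space_def)
  show "stable_poly {1..n} (perm_operator n c f)"
    unfolding stable_poly_def
  proof (intro conjI allI impI)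
    show "perm_operator n c f \<in> polys_in {1..n}"
      using multiaffine_in_perm_operator[of f n c] f
      by (simp add: multiaffine_in_def multiaffine_space_def)
    fix z :: "nat \<Rightarrow> complex"
    assume z: "\<forall>i\<in>{1..n}. z i \<in> upper_half_plane"
    obtain p s r where disc: "0 \<le> s" "s < r" "z ` {1..n} \<subseteq> ball p s" "cball p r \<subseteq> upper_half_plane"
    proof (rule disc_in_upper_half_plane[of "z ` {1..n}"])
      show "Im x > 0" if "x \<in> z ` {1..n}" for x
        using z that by (auto simp: upper_half_plane_def)
    qed auto
    \<comment> \<open>Grace's theorem summed over permutations, with \<open>z (\<sigma> j)\<close>
      as the value substituted for variable \<open>j\<close>; \<open>f\<close> has no zero with all
      coordinates in the larger disc.\<close>
    have "(\<Sum>\<sigma> | \<sigma> permutes {1..n}. c \<sigma> * poly_value f (\<lambda>j. if j \<in> {1..n} then z (\<sigma> j) else z j)) \<noteq> 0"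
    proof (rule grace_multivariate)
      show "poly_value f y \<noteq> 0" if "\<forall>j\<in>{1..n}. y j \<in> cball p r" for y
        using fst that disc(4) unfolding stable_poly_def by blast
      show "(\<Sum>\<sigma> | \<sigma> permutes {1..n}. c \<sigma> * (\<Prod>j\<in>{1..n}. v j * z (\<sigma> j) - w j)) \<noteq> 0"
        if vw: "\<forall>j\<in>{1..n}. outside_disc p r (v j) (w j)" for v w
      proof (rule inside_disc_nonzero[OF st, of z p s])
        fix j assume j: "j \<in> {1..n}"
        then show "z j \<in> ball p s"
          using disc(3) by blast
        show "v j = 1 \<and> w j \<notin> cball p s \<or> v j = 0 \<and> w j = -1"
          using bspec[OF vw j] disc(2) by (auto simp: outside_disc_def)
      qed
    qed (use disc in auto)
    \<comment> \<open>A permutation fixes every index outside \<open>{1..n}\<close>, so the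
      conditional disappears.\<close>
    moreover have "(\<lambda>j. if j \<in> {1..n} then z (\<sigma> j) else z j) = (\<lambda>j. z (\<sigma> j))"
      if "\<sigma> permutes {1..n}" for \<sigma>
      using permutes_not_in[OF that] by auto
    ultimately show "poly_value (perm_operator n c f) z \<noteq> 0"
      unfolding poly_value_perm_operator by simp
  qed
qed

text \<open>Test polynomials: their images under \<open>perm_operator\<close> are the sum polynomial
  with the \<open>w j\<close> fixed.\<close>

definition linear_product :: "nat \<Rightarrow> (nat \<Rightarrow> complex) \<Rightarrow> nat cpoly" where
  "linear_product n w = (\<Prod>j=1..n. Var j + Const (w j))"

lemma linear_product_multiaffine: "linear_product n w \<in> multiaffine_space n"
proof -
  have "linear_product n w \<in> multiaffine_in (\<Union>j\<in>{1..n}. {j})"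
    unfolding linear_product_def
    by (intro multiaffine_in_prod multiaffine_in_add multiaffine_in_Var multiaffine_in_Const)
      (auto simp: disjoint_family_on_def)
  then show ?thesis
    by (simp add: multiaffine_in_def multiaffine_space_def)
qed

lemma poly_value_linear_product: "poly_value (linear_product n w) x = (\<Prod>j=1..n. x j + w j)"
  by (simp add: linear_product_def)

lemma linear_product_stable:
  assumes "\<forall>j\<in>{1..n}. w j \<in> upper_half_plane"
  shows "stable_poly {1..n} (linear_product n w)"
proof -
  have "x j + w j \<noteq> 0" if "j \<in> {1..n}" "x j \<in> upper_half_plane" for x j
  proof -
    have "Im (x j + w j) > 0"
      using that assms by (simp add: upper_half_plane_def add_pos_pos)
    then show ?thesis by force
  qed
  then show ?thesis
    using linear_product_multiaffine[of n w]
    by (auto simp: stable_poly_def multiaffine_space_def poly_value_linear_product)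
qed

text \<open>Permutations fix points with equal coordinates. Hence no image is stable if the
  \<open>c \<sigma>\<close> sum to 0, and otherwise stable polynomials have nonzero images.\<close>

lemma perm_operator_diagonal:
  "poly_value (perm_operator n c f) (\<lambda>_. a) =
     (\<Sum>\<sigma> | \<sigma> permutes {1..n}. c \<sigma>) * poly_value f (\<lambda>_. a)"
  by (simp add: poly_value_perm_operator sum_distrib_right)

text \<open>The nonzero image of \<open>f\<close> excludes that the \<open>c \<sigma>\<close> sum to
  0. Then the stable linear products have nonzero, hence stable, images, whose values are the sums
  in question.\<close>

lemma half_plane_stable_if_preserves_stability:
  assumes f: "f \<in> multiaffine_space n" and nz: "perm_operator n c f \<noteq> 0"
    and pres: "preserves_stability n (perm_operator n c)"
  shows "half_plane_stable n c"
proof -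
  let ?s = "\<Sum>\<sigma> | \<sigma> permutes {1..n}. c \<sigma>"
  have i: "\<i> \<in> upper_half_plane"
    by (simp add: upper_half_plane_def)
  have alt: "stable_poly {1..n} (perm_operator n c (linear_product n w)) \<or>
      perm_operator n c (linear_product n w) = 0" if "\<forall>j\<in>{1..n}. w j \<in> upper_half_plane" for w
    using pres linear_product_stable[OF that] linear_product_multiaffine
    unfolding preserves_stability_def by blast
  have s: "?s \<noteq> 0"
  proof
    assume s0: "?s = 0"
    interpret affine_in_each_variable "poly_value f"
      using f by (intro affine_in_each_variable_poly_value) (simp add: multiaffine_space_def)
    have zero: "(\<Sum>\<sigma> | \<sigma> permutes {1..n}. c \<sigma> * (\<Prod>j\<in>{1..n}. x (\<sigma> j) + w j)) = 0"
      if w: "\<forall>j\<in>{1..n}. w j \<in> upper_half_plane" for x w :: "nat \<Rightarrow> complex"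
    proof -
      \<comment> \<open>The image vanishes at the diagonal point \<open>\<i>\<close>, which leaves
        only the zero polynomial.\<close>
      have "\<not> stable_poly {1..n} (perm_operator n c (linear_product n w))"
        using i perm_operator_diagonal[of n c "linear_product n w" \<i>] s0
        unfolding stable_poly_def by auto
      then have "perm_operator n c (linear_product n w) = 0"
        using alt[OF w] by blast
      then have "poly_value (perm_operator n c (linear_product n w)) x = 0"
        by simp
      then show ?thesis
        by (simp add: poly_value_perm_operator poly_value_linear_product)
    qed
    have "poly_value (perm_operator n c f) x = 0" for x
    proof -
      \<comment> \<open>The vanishing passes from the linear products to \<open>f\<close>.\<close>
      have "(\<Sum>\<sigma> | \<sigma> permutes {1..n}. c \<sigma> * poly_value f (\<lambda>j. if j \<in> {1..n} then x (\<sigma> j) else x j)) = 0"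
        by (rule vanishing_on_products[OF finite_atLeastAtMost zero])
      moreover have "(\<lambda>j. if j \<in> {1..n} then x (\<sigma> j) else x j) = (\<lambda>j. x (\<sigma> j))"
        if "\<sigma> permutes {1..n}" for \<sigma>
        using permutes_not_in[OF that] by auto
      ultimately show ?thesis
        unfolding poly_value_perm_operator by simp
    qed
    moreover have "multiaffine (perm_operator n c f)"
      using multiaffine_in_perm_operator[of f n c] f
      by (simp add: multiaffine_in_def multiaffine_space_def)
    ultimately show False
      using nz multiaffine_eq_zero by blast
  qed
  show ?thesis
    unfolding half_plane_stable_def
  proof (intro allI impI)
    fix z w :: "nat \<Rightarrow> complex"
    assume zw: "\<forall>j\<in>{1..n}. Im (z j) > 0 \<and> Im (w j) < 0"
    let ?f = "linear_product n (\<lambda>j. - w j)"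
    have w: "\<forall>j\<in>{1..n}. - w j \<in> upper_half_plane"
      using zw by (simp add: upper_half_plane_def)
    have "poly_value ?f (\<lambda>_. \<i>) \<noteq> 0"
      using linear_product_stable[OF w] i unfolding stable_poly_def by simp
    then have "poly_value (perm_operator n c ?f) (\<lambda>_. \<i>) \<noteq> 0"
      using s by (simp add: perm_operator_diagonal)
    then have "stable_poly {1..n} (perm_operator n c ?f)"
      using alt[OF w] by auto
    then have "poly_value (perm_operator n c ?f) z \<noteq> 0"
      using zw unfolding stable_poly_def by (simp add: upper_half_plane_def)
    then show "(\<Sum>\<sigma> | \<sigma> permutes {1..n}. c \<sigma> * (\<Prod>j=1..n. z (\<sigma> j) - w j)) \<noteq> 0"
      by (simp add: poly_value_perm_operator poly_value_linear_product)
  qed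
qed

theorem proposition4:
  fixes n :: nat and c :: "(nat \<Rightarrow> nat) \<Rightarrow> complex"
  shows "(grace_like n (difference_poly n c) \<longleftrightarrow> stable_poly (zw_vars n) (sum_poly n c)) \<and>
    (grace_like n (difference_poly n c) \<longrightarrow> preserves_stability n (perm_operator n c)) \<and>
    ((\<exists>f \<in> multiaffine_space n. perm_operator n c f \<noteq> 0) \<longrightarrow>
      preserves_stability n (perm_operator n c) \<longrightarrow> grace_like n (difference_poly n c))"
  \<comment> \<open>Both polynomial conditions become \<open>half_plane_stable\<close>, leaving the
    two implications about the operator.\<close>
  unfolding grace_like_iff stable_sum_poly_iff
  using preserves_stability_if_half_plane_stable half_plane_stable_if_preserves_stability by blast

end
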